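(* Let $\Gamma$ be an infinite discrete group (not necessarily countable), let $k \geq 1$ be an integer, and let $V \subseteq k^\Gamma$ be a nonempty open set. Then there exists $n \in \mathbb{N}$ such that for every finite set $F \subset \Gamma$ with $|F| \geq n$, the set $F \cdot V = \{\sigma \cdot v : \sigma \in F,\ v \in V\}$ traps a point; that is, there exists $x \in k^\Gamma$ such that $\gamma \cdot x \in F \cdot V$ for all $\gamma \in \Gamma$.
   Context: For an integer $k \geq 1$, identify $k$ with the $k$-element set $\{i \in \mathbb{N} : i < k\}$ equipped with the discrete topology. The space $k^\Gamma$ of all functions $\Gamma \to k$ carries the product topology, and $\Gamma$ acts on it by $(\gamma \cdot x)(\delta) := x(\delta\gamma)$ for all $\gamma, \delta \in \Gamma$ and $x \in k^\Gamma$. Given a continuous action of $\Gamma$ on a nonempty compact Hausdorff space $X$, a set $U \subseteq X$ traps a point $x \in X$ if the orbit $\{\gamma \cdot x : \gamma \in \Gamma\}$ of $x$ is contained in $U$. *)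

theory Defs
  imports "HOL-Analysis.Analysis" "HOL-Algebra.Group_Action"
begin

definition shift_space :: "nat \<Rightarrow> ('a, 'b) monoid_scheme \<Rightarrow> ('a \<Rightarrow> nat) topology" where
  "shift_space k G = product_topology (\<lambda>_. discrete_topology {..<k}) (carrier G)"

text \<open>
  Points of \<^term>\<open>shift_space k G\<close> are extensional functions on \<^term>\<open>carrier G\<close>, and the
  bijections making up a \<^const>\<open>group_action\<close> are extensional on the space acted upon;
  the two restrictions in the following definition account for this.
\<close>

definition shift_act :: "nat \<Rightarrow> ('a, 'b) monoid_scheme \<Rightarrow> 'a \<Rightarrow> ('a \<Rightarrow> nat) \<Rightarrow> 'a \<Rightarrow> nat" where
  "shift_act k G \<gamma> =
     (\<lambda>x \<in> topspace (shift_space k G). \<lambda>\<delta> \<in> carrier G. x (\<delta> \<otimes>\<^bsub>G\<^esub> \<gamma>))"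

definition traps ::
  "('a, 'c) monoid_scheme \<Rightarrow> ('a \<Rightarrow> 'b \<Rightarrow> 'b) \<Rightarrow> 'b set \<Rightarrow> 'b \<Rightarrow> bool" where
  "traps G \<phi> U x \<longleftrightarrow> orbit G \<phi> x \<subseteq> U"

definition translates :: "('a \<Rightarrow> 'b \<Rightarrow> 'b) \<Rightarrow> 'a set \<Rightarrow> 'b set \<Rightarrow> 'b set" where
  "translates \<phi> F V = {\<phi> \<sigma> v | \<sigma> v. \<sigma> \<in> F \<and> v \<in> V}"

lemma topspace_shift_space: "topspace (shift_space k G) = carrier G \<rightarrow>\<^sub>E {..<k}"
  by (simp add: shift_space_def)

lemma shift_act_closed:
  assumes "group G" "\<gamma> \<in> carrier G" "x \<in> topspace (shift_space k G)"
  shows "shift_act k G \<gamma> x \<in> topspace (shift_space k G)"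
proof -
  interpret group G by fact
  show ?thesis
    using assms by (auto simp: shift_act_def topspace_shift_space PiE_iff)
qed

lemma shift_act_mult:
  assumes "group G" "\<gamma> \<in> carrier G" "\<gamma>' \<in> carrier G" "x \<in> topspace (shift_space k G)"
  shows "shift_act k G (\<gamma> \<otimes>\<^bsub>G\<^esub> \<gamma>') x = shift_act k G \<gamma> (shift_act k G \<gamma>' x)"
proof -
  interpret group G by fact
  show ?thesis
    using shift_act_closed[OF assms(1,3,4)] assms
    by (auto simp: shift_act_def fun_eq_iff m_assoc)
qed

lemma shift_act_one:
  assumes "group G" "x \<in> topspace (shift_space k G)"
  shows "shift_act k G \<one>\<^bsub>G\<^esub> x = x"
proof -
  interpret group G by fact
  show ?thesis
    using assms
    by (auto simp: shift_act_def topspace_shift_space PiE_iff extensional_def fun_eq_iff)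
qed

lemma shift_act_group_action:
  assumes "group G"
  shows "group_action G (topspace (shift_space k G)) (shift_act k G)"
proof -
  interpret group G by fact
  let ?E = "topspace (shift_space k G)"
  have bij: "shift_act k G \<gamma> \<in> Bij ?E" if g: "\<gamma> \<in> carrier G" for \<gamma>
  proof -
    have "bij_betw (shift_act k G \<gamma>) ?E ?E"
    proof (rule bij_betw_byWitness[where f' = "shift_act k G (inv\<^bsub>G\<^esub> \<gamma>)"])
      show "\<forall>a\<in>?E. shift_act k G (inv\<^bsub>G\<^esub> \<gamma>) (shift_act k G \<gamma> a) = a"
        using g assms by (simp flip: shift_act_mult add: shift_act_one)
      show "\<forall>a\<in>?E. shift_act k G \<gamma> (shift_act k G (inv\<^bsub>G\<^esub> \<gamma>) a) = a"
        using g assms by (simp flip: shift_act_mult add: shift_act_one)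
    qed (use g assms in \<open>auto intro: shift_act_closed\<close>)
    moreover have "shift_act k G \<gamma> \<in> extensional ?E"
      by (simp add: shift_act_def)
    ultimately show ?thesis
      by (simp add: Bij_def)
  qed
  have "shift_act k G (\<gamma> \<otimes>\<^bsub>G\<^esub> \<gamma>') = compose ?E (shift_act k G \<gamma>) (shift_act k G \<gamma>')"
    if "\<gamma> \<in> carrier G" "\<gamma>' \<in> carrier G" for \<gamma> \<gamma>'
  proof (rule extensionalityI[where A = ?E])
    show "shift_act k G (\<gamma> \<otimes>\<^bsub>G\<^esub> \<gamma>') \<in> extensional ?E"
      by (simp add: shift_act_def)
  qed (use that assms in \<open>auto simp: compose_def shift_act_mult\<close>)
  with bij have "shift_act k G \<in> hom G (BijGroup ?E)"
    by (auto simp: hom_def BijGroup_def)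
  then show ?thesis
    by (simp add: group_action_def group_hom_def group_hom_axioms_def group_BijGroup is_group)
qed

end

theory Submission
  imports Defs
begin

text \<open>
  A nonempty open set contains the cylinder of a pattern \<open>y\<close> on a finite set \<open>D\<close>, so one needs
  a colouring \<open>x\<close> such that for every \<open>\<gamma>\<close> there is a \<open>\<sigma> \<in> F\<close> for which the pattern occurs on
  \<open>D \<sigma>\<inverse> \<gamma>\<close>. If \<open>F\<close> is large, it contains \<open>N\<close> elements \<open>\<sigma>\<close> for which the sets \<open>D \<sigma>\<inverse>\<close> are pairwise
  disjoint; the constraint belonging to \<open>\<gamma>\<close> then involves \<open>m = N |D|\<close> coordinates, every coordinate
  occurs in at most \<open>m\<close> constraints, and only a proportion of \<open>(1 - k\<^sup>-\<^sup>|\<^sup>D\<^sup>|)\<^sup>N\<close> of the patterns violate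
  a given one. The Lovasz Local Lemma would apply; its place is taken here by Rosenfeld's counting
  argument, in which every further coordinate multiplies the number of admissible colourings by at
  least \<open>\<beta> = k (1 - 1 / (2 m))\<close>. Tychonoff's theorem passes from finite to infinite sets of coordinates.
\<close>

section \<open>Cylinders and compactness\<close>

definition cylinder :: "'a set \<Rightarrow> ('a \<Rightarrow> 'c set) \<Rightarrow> ('a \<Rightarrow> 'c) \<Rightarrow> 'a set \<Rightarrow> ('a \<Rightarrow> 'c) set" where
  "cylinder C K y D = {x \<in> Pi\<^sub>E C K. \<forall>d\<in>D. x d = y d}"

lemma openin_cylinder:
  assumes "finite D" "D \<subseteq> C"
  shows "openin (product_topology (\<lambda>a. discrete_topology (K a)) C) (cylinder C K y D)"
proof -
  let ?U = "\<lambda>a. {c \<in> K a. a \<in> D \<longrightarrow> c = y a}"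
  have "cylinder C K y D = Pi\<^sub>E C ?U"
    using assms(2) by (auto simp: cylinder_def PiE_iff extensional_def)
  moreover have "finite {a \<in> C. ?U a \<noteq> K a}"
    by (rule finite_subset[OF _ assms(1)]) auto
  ultimately show ?thesis
    by (auto simp: openin_PiE_gen)
qed

lemma ex_cylinder_subset:
  assumes "openin (product_topology (\<lambda>a. discrete_topology (K a)) C) V" "y \<in> V"
  obtains D where "finite D" "D \<subseteq> C" "cylinder C K y D \<subseteq> V"
proof -
  obtain U where U: "finite {a \<in> C. U a \<noteq> K a}" "y \<in> Pi\<^sub>E C U" "Pi\<^sub>E C U \<subseteq> V"
    using assms by (fastforce simp: openin_product_topology_alt)
  have "x \<in> Pi\<^sub>E C U" if "x \<in> cylinder C K y {a \<in> C. U a \<noteq> K a}" for x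
  proof (rule PiE_I)
    fix a assume "a \<in> C"
    with that U(2) show "x a \<in> U a"
      by (cases "U a = K a") (auto simp: cylinder_def)
  qed (use that in \<open>auto simp: cylinder_def\<close>)
  with U(3) have "cylinder C K y {a \<in> C. U a \<noteq> K a} \<subseteq> V"
    by blast
  with U(1) that show thesis
    by simp
qed

lemma openin_finite_restriction:
  assumes "finite A" "A \<subseteq> C"
  shows "openin (product_topology (\<lambda>a. discrete_topology (K a)) C)
    {x \<in> Pi\<^sub>E C K. restrict x A \<in> P}"
    (is "openin _ ?U")
proof (subst openin_subopen, intro ballI exI conjI)
  fix x assume x: "x \<in> ?U"
  then show "openin (product_topology (\<lambda>a. discrete_topology (K a)) C) (cylinder C K x A)"
    using assms by (intro openin_cylinder) auto
  show "x \<in> cylinder C K x A"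
    using x by (simp add: cylinder_def)
  show "cylinder C K x A \<subseteq> ?U"
  proof
    fix z assume "z \<in> cylinder C K x A"
    then have "z \<in> Pi\<^sub>E C K" "restrict z A = restrict x A"
      by (auto simp: cylinder_def intro!: restrict_ext)
    with x show "z \<in> ?U"
      by simp
  qed
qed

lemma closedin_finite_restriction:
  assumes "finite A" "A \<subseteq> C"
  shows "closedin (product_topology (\<lambda>a. discrete_topology (K a)) C)
    {x \<in> Pi\<^sub>E C K. restrict x A \<in> P}"
proof -
  have "Pi\<^sub>E C K - {x \<in> Pi\<^sub>E C K. restrict x A \<in> P} = {x \<in> Pi\<^sub>E C K. restrict x A \<in> - P}"
    by auto
  then show ?thesis
    using openin_finite_restriction[OF assms, of K "- P"] by (auto simp: closedin_def)
qed

lemma ex_PiE_restrict_eq: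
  assumes "p \<in> Pi\<^sub>E A K" "A \<subseteq> C" "\<And>a. a \<in> C \<Longrightarrow> K a \<noteq> {}"
  shows "\<exists>x \<in> Pi\<^sub>E C K. restrict x A = p"
proof -
  have "Pi\<^sub>E C K \<noteq> {}"
    using assms(3) by (simp add: PiE_eq_empty_iff)
  then obtain w where "w \<in> Pi\<^sub>E C K"
    by blast
  then have "(\<lambda>a\<in>C. if a \<in> A then p a else w a) \<in> Pi\<^sub>E C K"
    using assms(1) by auto
  moreover have "restrict (\<lambda>a\<in>C. if a \<in> A then p a else w a) A = restrict p A"
    using assms(2) by (auto simp: fun_eq_iff)
  ultimately show ?thesis
    using PiE_restrict[OF assms(1)] by metis
qed

lemma compact_space_directed_Inter_nonempty:
  assumes "compact_space X"
    and closed: "\<And>A. A \<in> \<A> \<Longrightarrow> closedin X (Z A)"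
    and nonempty: "\<And>A. A \<in> \<A> \<Longrightarrow> Z A \<noteq> {}"
    and directed: "\<And>\<B>. finite \<B> \<Longrightarrow> \<B> \<subseteq> \<A> \<Longrightarrow> \<exists>A\<in>\<A>. \<forall>B\<in>\<B>. Z A \<subseteq> Z B"
  shows "\<Inter>(Z ` \<A>) \<noteq> {}"
proof -
  have finite_intersections: "\<Inter>\<F> \<noteq> {}" if "finite \<F>" "\<F> \<subseteq> Z ` \<A>" for \<F>
  proof -
    obtain \<B> where \<B>: "finite \<B>" "\<B> \<subseteq> \<A>" "\<F> = Z ` \<B>"
      using finite_subset_image[OF \<open>finite \<F>\<close> \<open>\<F> \<subseteq> Z ` \<A>\<close>] by auto
    obtain A where A: "A \<in> \<A>" "\<forall>B\<in>\<B>. Z A \<subseteq> Z B"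
      using directed[OF \<B>(1,2)] by blast
    then have "Z A \<subseteq> \<Inter>\<F>"
      unfolding \<B>(3) by (intro INT_greatest) simp
    with nonempty[OF A(1)] show ?thesis
      by auto
  qed
  show ?thesis
    using assms(1) closed finite_intersections unfolding compact_space_fip by simp
qed

lemma ex_PiE_all_finite_restrictions:
  assumes finite_colours: "\<And>a. a \<in> C \<Longrightarrow> finite (K a)"
    and partial: "\<And>A. finite A \<Longrightarrow> A \<subseteq> C \<Longrightarrow> Q A \<subseteq> Pi\<^sub>E A K"
    and nonempty: "\<And>A. finite A \<Longrightarrow> A \<subseteq> C \<Longrightarrow> Q A \<noteq> {}"
    and restrict: "\<And>A A' x. A' \<subseteq> A \<Longrightarrow> x \<in> Q A \<Longrightarrow> restrict x A' \<in> Q A'"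
  shows "\<exists>x \<in> Pi\<^sub>E C K. \<forall>A. finite A \<and> A \<subseteq> C \<longrightarrow> restrict x A \<in> Q A"
proof -
  define Z where "Z A = {x \<in> Pi\<^sub>E C K. restrict x A \<in> Q A}" for A
  let ?\<A> = "{A. finite A \<and> A \<subseteq> C}"
  have colours: "K a \<noteq> {}" if "a \<in> C" for a
    using partial[of "{a}"] nonempty[of "{a}"] that by fastforce
  have Z_antimono: "Z A \<subseteq> Z A'" if "A' \<subseteq> A" for A A'
  proof -
    have "restrict x A' \<in> Q A'" if "restrict x A \<in> Q A" for x
      using restrict[OF \<open>A' \<subseteq> A\<close> that] \<open>A' \<subseteq> A\<close> by (simp add: Int_absorb1)
    then show ?thesis
      by (auto simp: Z_def)
  qed
  have "\<Inter>(Z ` ?\<A>) \<noteq> {}"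
  proof (rule compact_space_directed_Inter_nonempty)
    show "compact_space (product_topology (\<lambda>a. discrete_topology (K a)) C)"
      using finite_colours
      by (simp add: compact_space_product_topology compact_space_discrete_topology)
  next
    fix A assume A: "A \<in> ?\<A>"
    then show "closedin (product_topology (\<lambda>a. discrete_topology (K a)) C) (Z A)"
      using closedin_finite_restriction by (auto simp: Z_def)
    obtain p where p: "p \<in> Q A" "p \<in> Pi\<^sub>E A K"
      using A nonempty[of A] partial[of A] by auto
    then have "\<exists>x \<in> Pi\<^sub>E C K. restrict x A = p"
      using A colours by (intro ex_PiE_restrict_eq) auto
    with p(1) show "Z A \<noteq> {}"
      by (auto simp: Z_def)
  next
    fix \<B> assume "finite \<B>" "\<B> \<subseteq> ?\<A>"
    then show "\<exists>A\<in>?\<A>. \<forall>B\<in>\<B>. Z A \<subseteq> Z B"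
      by (intro bexI[of _ "\<Union>\<B>"] ballI Z_antimono) auto
  qed
  then obtain x where x: "x \<in> Z A" if "finite A" "A \<subseteq> C" for A
    by auto
  then have "x \<in> Pi\<^sub>E C K"
    using x[of "{}"] by (simp add: Z_def)
  with x show ?thesis
    by (auto simp: Z_def)
qed

section \<open>Colourings avoiding local patterns\<close>

locale forbidden_patterns =
  fixes K :: "'a \<Rightarrow> 'c set" and I :: "'i set" and S :: "'i \<Rightarrow> 'a set" and B :: "'i \<Rightarrow> ('a \<Rightarrow> 'c) set"
  assumes finite_colours: "finite (K a)"
    and finite_support: "i \<in> I \<Longrightarrow> finite (S i)"
    and support_nonempty: "i \<in> I \<Longrightarrow> S i \<noteq> {}"
    and finite_forbidden: "i \<in> I \<Longrightarrow> finite (B i)"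
    and finite_incident: "finite {i \<in> I. a \<in> S i}"
begin

definition avoiding :: "'a set \<Rightarrow> ('a \<Rightarrow> 'c) set" where
  "avoiding A = {x \<in> Pi\<^sub>E A K. \<forall>i\<in>I. S i \<subseteq> A \<longrightarrow> restrict x (S i) \<notin> B i}"

lemma avoiding_subset_PiE: "avoiding A \<subseteq> Pi\<^sub>E A K"
  by (auto simp: avoiding_def)

lemma finite_avoiding: "finite A \<Longrightarrow> finite (avoiding A)"
  by (rule finite_subset[OF avoiding_subset_PiE]) (simp add: finite_PiE finite_colours)

lemma restrict_avoiding:
  assumes "A' \<subseteq> A" "x \<in> avoiding A"
  shows "restrict x A' \<in> avoiding A'"
proof -
  have "restrict (restrict x A') (S i) = restrict x (S i)" if "S i \<subseteq> A'" for i
    using that by (simp add: Int_absorb1)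
  with assms show ?thesis
    by (fastforce simp: avoiding_def PiE_iff)
qed

definition extensions :: "'a \<Rightarrow> 'a set \<Rightarrow> ('a \<Rightarrow> 'c) set" where
  "extensions v A = (\<lambda>(c, x). x(v := c)) ` (K v \<times> avoiding A)"

lemma finite_extensions: "finite A \<Longrightarrow> finite (extensions v A)"
  by (simp add: extensions_def finite_avoiding finite_colours)

lemma extensions_subset_PiE: "extensions v A \<subseteq> Pi\<^sub>E (insert v A) K"
  unfolding extensions_def PiE_insert_eq
  by (intro image_mono Sigma_mono avoiding_subset_PiE order_refl)

lemma restrict_extension:
  assumes "v \<notin> A" "x \<in> extensions v A"
  shows "restrict x A \<in> avoiding A"
proof -
  obtain c y where x: "x = y(v := c)" and y: "y \<in> avoiding A"
    using assms(2) by (auto simp: extensions_def)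
  then have "restrict x A = restrict y A"
    using \<open>v \<notin> A\<close> by (auto simp: fun_eq_iff)
  also have "\<dots> = y"
    using y by (auto simp: avoiding_def)
  finally show ?thesis
    using y by simp
qed

lemma card_extensions:
  assumes "v \<notin> A"
  shows "card (extensions v A) = card (K v) * card (avoiding A)"
proof -
  have "inj_on (\<lambda>(c, x). x(v := c)) (K v \<times> avoiding A)"
    by (rule inj_on_subset[OF inj_combinator[OF assms, of K]]) (use avoiding_subset_PiE in auto)
  then show ?thesis
    by (simp add: extensions_def card_image card_cartesian_product)
qed

lemma extensions_subset_avoiding_insert:
  assumes "v \<notin> A"
  shows "extensions v A \<subseteq> avoiding (insert v A) \<union>
    (\<Union>i \<in> {i \<in> I. v \<in> S i \<and> S i \<subseteq> insert v A}. {x \<in> extensions v A. restrict x (S i) \<in> B i})"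
proof (rule subsetI, rule UnCI)
  fix x assume x: "x \<in> extensions v A"
    and no_violation:
      "x \<notin> (\<Union>i \<in> {i \<in> I. v \<in> S i \<and> S i \<subseteq> insert v A}. {x \<in> extensions v A. restrict x (S i) \<in> B i})"
  have "restrict x (S i) \<notin> B i" if "i \<in> I" "S i \<subseteq> insert v A" for i
  proof (cases "v \<in> S i")
    case True
    with no_violation x that show ?thesis
      by auto
  next
    case False
    with that have "S i \<subseteq> A"
      by auto
    then have "restrict (restrict x A) (S i) = restrict x (S i)"
      by (simp add: Int_absorb1)
    then show ?thesis
      using restrict_extension[OF assms x] \<open>i \<in> I\<close> \<open>S i \<subseteq> A\<close> by (auto simp: avoiding_def)
  qed
  with x extensions_subset_PiE show "x \<in> avoiding (insert v A)"
    by (auto simp: avoiding_def)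
qed

lemma card_violating_extensions:
  assumes "finite A" "v \<notin> A" "i \<in> I" "v \<in> S i"
  shows "card {x \<in> extensions v A. restrict x (S i) \<in> B i} \<le> card (B i) * card (avoiding (A - S i))"
    (is "card ?X \<le> _")
proof -
  let ?f = "\<lambda>x. (restrict x (S i), restrict x (A - S i))"
  have "inj_on ?f ?X"
  proof (rule inj_onI)
    fix x z assume xz: "x \<in> ?X" "z \<in> ?X" and "?f x = ?f z"
    then have agree: "restrict x (S i) a = restrict z (S i) a"
        "restrict x (A - S i) a = restrict z (A - S i) a" for a
      by simp_all
    have "x a = z a" if "a \<in> insert v A" for a
      using that agree[of a] \<open>v \<in> S i\<close> by (cases "a \<in> S i") auto
    moreover have "x \<in> Pi\<^sub>E (insert v A) K" "z \<in> Pi\<^sub>E (insert v A) K"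
      using xz extensions_subset_PiE by auto
    ultimately show "x = z"
      by (intro PiE_ext)
  qed
  moreover have "?f ` ?X \<subseteq> B i \<times> avoiding (A - S i)"
    using restrict_avoiding[OF Diff_subset restrict_extension[OF \<open>v \<notin> A\<close>], of _ "S i"]
    by (auto simp: Int_absorb1)
  moreover have "finite (B i \<times> avoiding (A - S i))"
    using assms by (simp add: finite_forbidden finite_avoiding)
  ultimately have "card ?X \<le> card (B i \<times> avoiding (A - S i))"
    by (rule card_inj_on_le)
  then show ?thesis
    by (simp add: card_cartesian_product)
qed

lemma card_extensions_le:
  assumes "finite A" "v \<notin> A"
  shows "card (K v) * card (avoiding A) \<le> card (avoiding (insert v A)) +
    (\<Sum>i | i \<in> I \<and> v \<in> S i \<and> S i \<subseteq> insert v A. card (B i) * card (avoiding (A - S i)))"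
proof -
  let ?J = "{i \<in> I. v \<in> S i \<and> S i \<subseteq> insert v A}"
  let ?X = "\<lambda>i. {x \<in> extensions v A. restrict x (S i) \<in> B i}"
  have finite_J: "finite ?J"
    by (rule finite_subset[OF _ finite_incident[of v]]) auto
  have "card (K v) * card (avoiding A) = card (extensions v A)"
    using assms by (simp add: card_extensions)
  also have "\<dots> \<le> card (avoiding (insert v A) \<union> (\<Union>i\<in>?J. ?X i))"
    using \<open>finite A\<close> finite_J extensions_subset_avoiding_insert[OF \<open>v \<notin> A\<close>]
    by (intro card_mono) (auto simp: finite_avoiding finite_extensions)
  also have "\<dots> \<le> card (avoiding (insert v A)) + (\<Sum>i\<in>?J. card (?X i))"
    by (rule order_trans[OF card_Un_le add_left_mono[OF card_UN_le[OF finite_J]]])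
  also have "(\<Sum>i\<in>?J. card (?X i)) \<le> (\<Sum>i\<in>?J. card (B i) * card (avoiding (A - S i)))"
    using assms by (intro sum_mono card_violating_extensions) auto
  finally show ?thesis
    by simp
qed

end

lemma power_card_Diff_le:
  fixes f :: "'a set \<Rightarrow> real"
  assumes "finite T" "T \<subseteq> A" "\<beta> \<ge> 0"
    and step: "\<And>A' t. A' \<subset> A \<Longrightarrow> t \<in> A - A' \<Longrightarrow> \<beta> * f A' \<le> f (insert t A')"
  shows "\<beta> ^ card T * f (A - T) \<le> f A"
  using assms(1,2)
proof (induction T rule: finite_induct)
  case empty
  then show ?case
    by simp
next
  case (insert t T)
  have "\<beta> * f (A - insert t T) \<le> f (insert t (A - insert t T))"
    using insert.prems by (intro step) auto
  also have "insert t (A - insert t T) = A - T"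
    using insert by auto
  finally have "\<beta> ^ card T * (\<beta> * f (A - insert t T)) \<le> \<beta> ^ card T * f (A - T)"
    using \<open>\<beta> \<ge> 0\<close> by (intro mult_left_mono) auto
  also have "\<dots> \<le> f A"
    using insert by simp
  finally show ?case
    using insert.hyps by (simp add: mult_ac)
qed

locale sparse_forbidden_patterns = forbidden_patterns K I S B
  for K :: "'a \<Rightarrow> 'c set" and I :: "'i set" and S :: "'i \<Rightarrow> 'a set" and B :: "'i \<Rightarrow> ('a \<Rightarrow> 'c) set" +
  fixes \<beta> :: real
  assumes growth_pos: "\<beta> > 0"
    and growth: "\<beta> + (\<Sum>i | i \<in> I \<and> a \<in> S i. card (B i) / \<beta> ^ (card (S i) - 1)) \<le> card (K a)"
begin

lemma card_avoiding_insert: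
  assumes "finite A" "v \<notin> A"
  shows "\<beta> * card (avoiding A) \<le> card (avoiding (insert v A))"
  using assms
proof (induction A arbitrary: v rule: finite_psubset_induct)
  case (psubset A)
  let ?J = "{i \<in> I. v \<in> S i \<and> S i \<subseteq> insert v A}"
  let ?w = "\<lambda>i. card (B i) / \<beta> ^ (card (S i) - 1)"
  have remove: "card (avoiding (A - S i)) \<le> card (avoiding A) / \<beta> ^ (card (S i) - 1)"
    if i: "i \<in> ?J" for i
  proof -
    have "\<beta> ^ card (S i - {v}) * card (avoiding (A - (S i - {v}))) \<le> card (avoiding A)"
      using psubset i growth_pos finite_support
      by (intro power_card_Diff_le[where f = "\<lambda>A. card (avoiding A)"]) auto
    moreover have "A - (S i - {v}) = A - S i"
      using \<open>v \<notin> A\<close> by auto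
    moreover have "card (S i - {v}) = card (S i) - 1"
      using i finite_support by simp
    ultimately show ?thesis
      using growth_pos by (simp add: field_simps)
  qed
  have "real (card (K v)) * card (avoiding A) \<le> card (avoiding (insert v A)) +
      (\<Sum>i\<in>?J. real (card (B i)) * card (avoiding (A - S i)))"
    using card_extensions_le[OF \<open>finite A\<close> \<open>v \<notin> A\<close>, THEN of_nat_mono[where 'a = real]] by simp
  also have "(\<Sum>i\<in>?J. real (card (B i)) * card (avoiding (A - S i))) \<le>
      (\<Sum>i\<in>?J. card (B i) * (card (avoiding A) / \<beta> ^ (card (S i) - 1)))"
    using remove by (intro sum_mono mult_left_mono) auto
  also have "\<dots> = (\<Sum>i\<in>?J. ?w i * card (avoiding A))"
    by simp
  also have "\<dots> \<le> (\<Sum>i | i \<in> I \<and> v \<in> S i. ?w i * card (avoiding A))"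
    using growth_pos by (intro sum_mono2 finite_incident) auto
  also have "\<dots> \<le> (card (K v) - \<beta>) * card (avoiding A)"
    using growth[of v] unfolding sum_distrib_right[symmetric] by (intro mult_right_mono) auto
  finally show ?case
    by (simp add: algebra_simps)
qed

lemma finite_avoiding_nonempty:
  assumes "finite A"
  shows "avoiding A \<noteq> {}"
proof -
  have "card (avoiding A) > 0"
    using assms
  proof (induction A rule: finite_induct)
    case empty
    have "avoiding {} = {\<lambda>_. undefined}"
      using support_nonempty by (auto simp: avoiding_def)
    then show ?case
      by simp
  next
    case (insert v A)
    then have "0 < \<beta> * card (avoiding A)"
      using growth_pos by simp
    also have "\<dots> \<le> card (avoiding (insert v A))"
      using insert by (intro card_avoiding_insert)
    finally show ?case
      by simp
  qed
  then show ?thesis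
    by auto
qed

lemma avoiding_nonempty: "avoiding C \<noteq> {}"
proof -
  have "\<exists>x \<in> Pi\<^sub>E C K. \<forall>A. finite A \<and> A \<subseteq> C \<longrightarrow> restrict x A \<in> avoiding A"
    using finite_colours avoiding_subset_PiE finite_avoiding_nonempty restrict_avoiding
    by (rule ex_PiE_all_finite_restrictions)
  then obtain x where x: "x \<in> Pi\<^sub>E C K"
    and restrict_x: "\<And>A. finite A \<Longrightarrow> A \<subseteq> C \<Longrightarrow> restrict x A \<in> avoiding A"
    by auto
  have "restrict x (S i) \<notin> B i" if "i \<in> I" "S i \<subseteq> C" for i
    using restrict_x[of "S i"] that finite_support by (auto simp: avoiding_def)
  with x show ?thesis
    by (auto simp: avoiding_def)
qed

end

lemma ex_growth_rate:
  fixes k a :: real and m :: nat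
  assumes "k > 0" "m \<ge> 1" "a \<ge> 0" and small: "4 * m * a \<le> k ^ m"
  obtains \<beta> where "\<beta> > 0" "\<beta> + a / \<beta> ^ (m - 1) \<le> k"
proof -
  define \<delta> where "\<delta> = 1 / (2 * real m)"
  have \<delta>: "0 < \<delta>" "\<delta> \<le> 1 / 2"
    using \<open>m \<ge> 1\<close> by (auto simp: \<delta>_def field_simps)
  have "1 / 2 \<le> 1 + real (m - 1) * (- \<delta>)"
    using \<open>m \<ge> 1\<close> by (simp add: \<delta>_def field_simps of_nat_diff)
  also have "\<dots> \<le> (1 + (- \<delta>)) ^ (m - 1)"
    using \<delta> by (intro Bernoulli_inequality) auto
  finally have half: "1 / 2 \<le> (1 - \<delta>) ^ (m - 1)"
    by simp
  have "2 * a \<le> k ^ m * \<delta>"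
    using small \<open>m \<ge> 1\<close> by (simp add: \<delta>_def field_simps)
  also have "k ^ m = k * k ^ (m - 1)"
    using \<open>m \<ge> 1\<close> by (simp flip: power_Suc)
  finally have "a \<le> k * \<delta> * (k ^ (m - 1) * (1 / 2))"
    by (simp add: mult_ac)
  also have "\<dots> \<le> k * \<delta> * (k ^ (m - 1) * (1 - \<delta>) ^ (m - 1))"
    using half \<delta> \<open>k > 0\<close> by (intro mult_left_mono) auto
  finally have "a / (k * (1 - \<delta>)) ^ (m - 1) \<le> k * \<delta>"
    using \<delta> \<open>k > 0\<close> by (simp add: divide_le_eq power_mult_distrib)
  then have "k * (1 - \<delta>) + a / (k * (1 - \<delta>)) ^ (m - 1) \<le> k"
    by (simp add: algebra_simps)
  moreover have "k * (1 - \<delta>) > 0"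
    using \<delta> \<open>k > 0\<close> by simp
  ultimately show thesis
    using that by blast
qed

lemma ex_square_times_power_le:
  fixes b c d :: nat
  assumes "b < c"
  obtains N where "N > 0" "4 * (d * N)\<^sup>2 * b ^ N \<le> c ^ N"
proof -
  define s where "s = sqrt (b / c)"
  have s: "0 \<le> s" "s < 1"
    using assms by (auto simp: s_def)
  have "(\<lambda>N. real N * s ^ N) \<longlonglongrightarrow> 0"
    using s by (intro powser_times_n_limit_0) auto
  then have "(\<lambda>N. 2 * real d * (real N * s ^ N)) \<longlonglongrightarrow> 0"
    by (rule tendsto_mult_right_zero)
  then have "\<forall>\<^sub>F N in sequentially. 2 * real d * (real N * s ^ N) < 1"
    by (rule order_tendstoD) simp
  then obtain N where N: "N > 0" "2 * real d * (real N * s ^ N) < 1"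
    using eventually_happens'[OF sequentially_bot eventually_conj[OF eventually_gt_at_top[of 0]]]
    by blast
  then have "(2 * real d * (real N * s ^ N))\<^sup>2 \<le> 1"
    using s by (intro power_le_one) auto
  moreover have "(s ^ N)\<^sup>2 = (s\<^sup>2) ^ N"
    by (simp add: mult.commute flip: power_mult)
  then have "(s ^ N)\<^sup>2 = real b ^ N / real c ^ N"
    by (simp add: s_def power_divide)
  ultimately have "real (4 * (d * N)\<^sup>2 * b ^ N) \<le> real (c ^ N)"
    using assms by (simp add: power_mult_distrib field_simps)
  then have "4 * (d * N)\<^sup>2 * b ^ N \<le> c ^ N"
    unfolding of_nat_le_iff .
  with N(1) show thesis
    by (rule that)
qed

section \<open>Patterns in groups\<close>

lemma set_mult_eq_image: "A <#>\<^bsub>G\<^esub> B = (\<lambda>(a, b). a \<otimes>\<^bsub>G\<^esub> b) ` (A \<times> B)"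
  by (auto simp: set_mult_def)

lemma finite_set_mult: "finite A \<Longrightarrow> finite B \<Longrightarrow> finite (A <#>\<^bsub>G\<^esub> B)"
  by (simp add: set_mult_eq_image)

lemma card_set_mult_le:
  assumes "finite A" "finite B"
  shows "card (A <#>\<^bsub>G\<^esub> B) \<le> card A * card B"
  using card_image_le[of "A \<times> B" "\<lambda>(a, b). a \<otimes>\<^bsub>G\<^esub> b"] assms
  by (simp add: set_mult_eq_image card_cartesian_product)

lemma card_patterns_missing:
  assumes "finite D" "finite H" "finite K" and y: "y \<in> D \<rightarrow> K"
  shows "card {p \<in> (D <#>\<^bsub>G\<^esub> H) \<rightarrow>\<^sub>E K. \<forall>h\<in>H. \<exists>d\<in>D. p (d \<otimes>\<^bsub>G\<^esub> h) \<noteq> y d}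
    \<le> (card K ^ card D - 1) ^ card H" (is "card ?P \<le> _")
proof -
  let ?Q = "H \<rightarrow>\<^sub>E ((D \<rightarrow>\<^sub>E K) - {restrict y D})"
  let ?f = "\<lambda>p. \<lambda>h\<in>H. \<lambda>d\<in>D. p (d \<otimes>\<^bsub>G\<^esub> h)"
  have "inj_on ?f ?P"
  proof (rule inj_onI)
    fix p q assume pq: "p \<in> ?P" "q \<in> ?P" and eq: "?f p = ?f q"
    have "p (d \<otimes>\<^bsub>G\<^esub> h) = q (d \<otimes>\<^bsub>G\<^esub> h)" if "d \<in> D" "h \<in> H" for d h
      using fun_cong[OF fun_cong[OF eq, of h], of d] that by simp
    with pq show "p = q"
      by (intro PiE_ext[of p "D <#>\<^bsub>G\<^esub> H" "\<lambda>_. K"]) (auto simp: set_mult_def)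
  qed
  moreover have "?f ` ?P \<subseteq> ?Q"
  proof (rule image_subsetI, rule restrict_PiE_iff[THEN iffD2], intro ballI DiffI)
    fix p h assume p: "p \<in> ?P" and h: "h \<in> H"
    then show "(\<lambda>d\<in>D. p (d \<otimes>\<^bsub>G\<^esub> h)) \<in> D \<rightarrow>\<^sub>E K"
      by (auto simp: set_mult_def PiE_iff)
    obtain d where "d \<in> D" "p (d \<otimes>\<^bsub>G\<^esub> h) \<noteq> y d"
      using p h by auto
    then show "(\<lambda>d\<in>D. p (d \<otimes>\<^bsub>G\<^esub> h)) \<notin> {restrict y D}"
      by (auto dest: fun_cong[of _ _ d])
  qed
  moreover have "finite ?Q"
    using assms by (simp add: finite_PiE)
  ultimately have "card ?P \<le> card ?Q"
    by (rule card_inj_on_le)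
  also have "card ?Q = (card K ^ card D - 1) ^ card H"
    using assms by (simp add: card_funcsetE finite_PiE)
  finally show ?thesis .
qed

lemma set_mult_insert: "A <#>\<^bsub>G\<^esub> insert b B = (A <#>\<^bsub>G\<^esub> B) \<union> (A #>\<^bsub>G\<^esub> b)"
  by (auto simp: set_mult_def r_coset_def)

context group
begin

lemma r_coset_Int_eq_empty:
  assumes "A \<subseteq> carrier G" "g \<in> carrier G" "g \<notin> set_inv A <#> B"
  shows "B \<inter> (A #> g) = {}"
proof (rule ccontr)
  assume "B \<inter> (A #> g) \<noteq> {}"
  then obtain a where "a \<in> A" "a \<otimes> g \<in> B"
    by (auto simp: r_coset_def)
  moreover have "g = inv a \<otimes> (a \<otimes> g)"
    using \<open>a \<in> A\<close> assms(1,2) by (auto simp flip: m_assoc)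
  ultimately show False
    using assms(3) by (auto simp: SET_INV_def set_mult_def)
qed

lemma card_set_inv_le: "finite A \<Longrightarrow> card (set_inv A) \<le> card A"
  using card_image_le[of A "m_inv G"] by (simp add: SET_INV_def UNION_singleton_eq_range)

lemma finite_r_coset: "finite D \<Longrightarrow> finite (D #> h)"
  by (simp add: r_coset_def)

lemma card_r_coset:
  assumes "D \<subseteq> carrier G" "h \<in> carrier G"
  shows "card (D #> h) = card D"
proof -
  have "D #> h = (\<lambda>d. d \<otimes> h) ` D"
    by (auto simp: r_coset_def)
  then show ?thesis
    using inj_on_g[OF assms] by (simp add: card_image)
qed

lemma translates_through_subset:
  assumes "E \<subseteq> carrier G"
  shows "{\<gamma> \<in> carrier G. v \<in> E #> \<gamma>} \<subseteq> (\<lambda>e. inv e \<otimes> v) ` E"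
proof clarify
  fix \<gamma> assume "\<gamma> \<in> carrier G" "v \<in> E #> \<gamma>"
  then obtain e where "e \<in> E" "v = e \<otimes> \<gamma>"
    by (auto simp: r_coset_def)
  then have "\<gamma> = inv e \<otimes> v"
    using assms \<open>\<gamma> \<in> carrier G\<close> by (auto simp: inv_solve_left)
  with \<open>e \<in> E\<close> show "\<gamma> \<in> (\<lambda>e. inv e \<otimes> v) ` E"
    by blast
qed

lemma finite_translates_through:
  assumes "finite E" "E \<subseteq> carrier G"
  shows "finite {\<gamma> \<in> carrier G. v \<in> E #> \<gamma>}"
  using finite_subset[OF translates_through_subset[OF assms(2)]] assms(1) by simp

lemma card_translates_through_le:
  assumes "finite E" "E \<subseteq> carrier G"
  shows "card {\<gamma> \<in> carrier G. v \<in> E #> \<gamma>} \<le> card E"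
  using assms(1) translates_through_subset[OF assms(2)] by (rule surj_card_le)

lemma ex_r_coset_disjoint:
  assumes "finite D" "D \<subseteq> carrier G" "finite A" "H \<subseteq> carrier G" and "card D * card A < card H"
  shows "\<exists>\<tau>\<in>H. A \<inter> (D #> \<tau>) = {}"
proof -
  have finite: "finite (set_inv D)"
    using assms(1) by (simp add: SET_INV_def)
  have "card (set_inv D <#> A) \<le> card (set_inv D) * card A"
    using finite assms(3) by (rule card_set_mult_le)
  also have "\<dots> \<le> card D * card A"
    using card_set_inv_le[OF assms(1)] by (rule mult_le_mono1)
  finally have "card (set_inv D <#> A) < card H"
    using assms(5) by simp
  then obtain \<tau> where "\<tau> \<in> H" "\<tau> \<notin> set_inv D <#> A"
    using card_mono[OF finite_set_mult[OF finite assms(3)], of H G] by force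
  then show ?thesis
    using r_coset_Int_eq_empty[OF assms(2)] assms(4) by blast
qed

lemma ex_subset_card_set_mult:
  assumes D: "finite D" "D \<noteq> {}" "D \<subseteq> carrier G" and H: "finite H" "H \<subseteq> carrier G"
    and "N * (card D)\<^sup>2 \<le> card H"
  shows "\<exists>H'\<subseteq>H. card H' = N \<and> card (D <#> H') = card D * N"
  using assms(6)
proof (induction N)
  case 0
  then show ?case
    by (intro exI[of _ "{}"]) (simp add: set_mult_def)
next
  case (Suc N)
  then obtain H' where H': "H' \<subseteq> H" "card H' = N" "card (D <#> H') = card D * N"
    by auto
  have finite: "finite H'" "finite (D <#> H')"
    using finite_subset[OF H'(1) H(1)] D(1) by (simp_all add: finite_set_mult)
  have "card D * card (D <#> H') < Suc N * (card D)\<^sup>2"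
    using D(1,2) by (simp add: H'(3) card_gt_0_iff power2_eq_square mult_ac)
  then obtain \<tau> where \<tau>: "\<tau> \<in> H" and disjoint: "(D <#> H') \<inter> (D #> \<tau>) = {}"
    using ex_r_coset_disjoint[OF D(1,3) finite(2) H(2)] Suc.prems by auto
  then have "\<tau> \<notin> H'"
    using D(2) by (auto simp: set_mult_def r_coset_def)
  then have "card (insert \<tau> H') = Suc N"
    using finite(1) H'(2) by simp
  moreover have "card (D <#> insert \<tau> H') = card D * Suc N"
  proof -
    have "finite (D #> \<tau>)" "card (D #> \<tau>) = card D"
      using D(1,3) H(2) \<tau> by (auto simp: finite_r_coset card_r_coset)
    then show ?thesis
      using disjoint finite(2) H'(3) by (simp add: set_mult_insert card_Un_disjoint)
  qed
  ultimately show ?case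
    using H'(1) \<tau> by (intro exI[of _ "insert \<tau> H'"]) simp
qed

definition translated_patterns :: "'a set \<Rightarrow> 'c set \<Rightarrow> ('a \<Rightarrow> 'c) set \<Rightarrow> 'a \<Rightarrow> ('a \<Rightarrow> 'c) set" where
  "translated_patterns E K P \<gamma> = {z \<in> (E #> \<gamma>) \<rightarrow>\<^sub>E K. (\<lambda>e\<in>E. z (e \<otimes> \<gamma>)) \<in> P}"

lemma finite_translated_patterns:
  "finite E \<Longrightarrow> finite K \<Longrightarrow> finite (translated_patterns E K P \<gamma>)"
  by (simp add: translated_patterns_def finite_PiE finite_r_coset)

lemma card_translated_patterns_le:
  assumes "finite P"
  shows "card (translated_patterns E K P \<gamma>) \<le> card P"
proof (rule card_inj_on_le[where f = "\<lambda>z. \<lambda>e\<in>E. z (e \<otimes> \<gamma>)"])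
  show "inj_on (\<lambda>z. \<lambda>e\<in>E. z (e \<otimes> \<gamma>)) (translated_patterns E K P \<gamma>)"
  proof (rule inj_onI)
    fix z w assume zw: "z \<in> translated_patterns E K P \<gamma>" "w \<in> translated_patterns E K P \<gamma>"
      and eq: "(\<lambda>e\<in>E. z (e \<otimes> \<gamma>)) = (\<lambda>e\<in>E. w (e \<otimes> \<gamma>))"
    have "z (e \<otimes> \<gamma>) = w (e \<otimes> \<gamma>)" if "e \<in> E" for e
      using fun_cong[OF eq, of e] that by simp
    with zw show "z = w"
      by (intro PiE_ext[of z "E #> \<gamma>" "\<lambda>_. K"]) (auto simp: translated_patterns_def r_coset_def)
  qed
qed (use assms in \<open>auto simp: translated_patterns_def\<close>)

lemma restrict_mem_translated_patterns_iff:
  assumes "E \<subseteq> carrier G" "\<gamma> \<in> carrier G" "x \<in> carrier G \<rightarrow>\<^sub>E K"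
  shows "restrict x (E #> \<gamma>) \<in> translated_patterns E K P \<gamma> \<longleftrightarrow> (\<lambda>e\<in>E. x (e \<otimes> \<gamma>)) \<in> P"
proof -
  have "restrict x (E #> \<gamma>) \<in> (E #> \<gamma>) \<rightarrow>\<^sub>E K"
    using r_coset_subset_G[OF assms(1,2)] assms(3) by auto
  moreover have "(\<lambda>e\<in>E. restrict x (E #> \<gamma>) (e \<otimes> \<gamma>)) = (\<lambda>e\<in>E. x (e \<otimes> \<gamma>))"
    by (rule restrict_ext) (auto simp: r_coset_def)
  ultimately show ?thesis
    unfolding translated_patterns_def by (simp only: mem_Collect_eq simp_thms)
qed

lemma sparse_translated_patterns:
  assumes E: "finite E" "E \<noteq> {}" "E \<subseteq> carrier G" and "finite K" "finite P"
    and \<beta>: "\<beta> > 0" "\<beta> + card E * card P / \<beta> ^ (card E - 1) \<le> card K"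
  shows "sparse_forbidden_patterns (\<lambda>_. K) (carrier G) (\<lambda>\<gamma>. E #> \<gamma>) (translated_patterns E K P) \<beta>"
proof
  fix v
  let ?J = "{\<gamma> \<in> carrier G. v \<in> E #> \<gamma>}"
  let ?w = "\<lambda>\<gamma>. card (translated_patterns E K P \<gamma>) / \<beta> ^ (card (E #> \<gamma>) - 1)"
  have "(\<Sum>\<gamma>\<in>?J. ?w \<gamma>) \<le> card ?J * (card P / \<beta> ^ (card E - 1))"
    using E \<beta> card_translated_patterns_le[OF \<open>finite P\<close>]
    by (intro sum_bounded_above) (simp add: card_r_coset divide_right_mono)
  also have "\<dots> \<le> card E * (card P / \<beta> ^ (card E - 1))"
    using card_translates_through_le[OF E(1,3)] \<beta> by (intro mult_right_mono) auto
  finally show "\<beta> + (\<Sum>\<gamma>\<in>?J. ?w \<gamma>) \<le> card K"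
    using \<beta> by simp
  show "finite ?J"
    using E(1,3) by (rule finite_translates_through)
qed (use assms in \<open>auto simp: finite_translated_patterns finite_r_coset r_coset_def\<close>)

lemma ex_colouring_avoiding_translates:
  assumes E: "finite E" "E \<noteq> {}" "E \<subseteq> carrier G" and K: "finite K" "K \<noteq> {}"
    and "finite P" and few: "4 * (card E)\<^sup>2 * card P \<le> card K ^ card E"
  shows "\<exists>x \<in> carrier G \<rightarrow>\<^sub>E K. \<forall>\<gamma>\<in>carrier G. (\<lambda>e\<in>E. x (e \<otimes> \<gamma>)) \<notin> P"
proof -
  have "real (card K) > 0" "card E \<ge> 1"
    using E K by (simp_all add: card_gt_0_iff Suc_le_eq)
  moreover have "4 * real (card E) * real (card E * card P) \<le> real (card K) ^ card E"
    using few[THEN of_nat_mono[where 'a = real]] by (simp add: power2_eq_square mult_ac)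
  ultimately obtain \<beta> where \<beta>: "\<beta> > 0" "\<beta> + card E * card P / \<beta> ^ (card E - 1) \<le> card K"
    using ex_growth_rate[of "card K" "card E" "card E * card P"] by auto
  interpret sparse_forbidden_patterns "\<lambda>_. K" "carrier G" "\<lambda>\<gamma>. E #> \<gamma>" "translated_patterns E K P" \<beta>
    using E K(1) \<open>finite P\<close> \<beta> by (rule sparse_translated_patterns)
  obtain x where x: "x \<in> avoiding (carrier G)"
    using avoiding_nonempty by blast
  then have x_PiE: "x \<in> carrier G \<rightarrow>\<^sub>E K"
    using avoiding_subset_PiE by blast
  have "(\<lambda>e\<in>E. x (e \<otimes> \<gamma>)) \<notin> P" if "\<gamma> \<in> carrier G" for \<gamma>
    using x that r_coset_subset_G[OF E(3) that]
      restrict_mem_translated_patterns_iff[OF E(3) that x_PiE, of P]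
    unfolding avoiding_def by blast
  with x_PiE show ?thesis
    by blast
qed

lemma ex_colouring_matching_translates:
  assumes D: "finite D" "D \<subseteq> carrier G" and H: "finite H" "H \<subseteq> carrier G"
    and K: "finite K" and y: "y \<in> D \<rightarrow> K"
    and card_DH: "card (D <#> H) = card D * card H" and "D \<noteq> {}" "H \<noteq> {}"
    and few: "4 * (card D * card H)\<^sup>2 * (card K ^ card D - 1) ^ card H \<le> (card K ^ card D) ^ card H"
  shows "\<exists>x \<in> carrier G \<rightarrow>\<^sub>E K. \<forall>\<gamma>\<in>carrier G. \<exists>h\<in>H. \<forall>d\<in>D. x (d \<otimes> h \<otimes> \<gamma>) = y d"
proof -
  let ?E = "D <#> H"
  let ?P = "{p \<in> ?E \<rightarrow>\<^sub>E K. \<forall>h\<in>H. \<exists>d\<in>D. p (d \<otimes> h) \<noteq> y d}"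
  have "4 * (card ?E)\<^sup>2 * card ?P \<le> 4 * (card D * card H)\<^sup>2 * (card K ^ card D - 1) ^ card H"
    using card_patterns_missing[OF D(1) H(1) K y, of G] by (simp add: card_DH)
  also have "\<dots> \<le> card K ^ card ?E"
    using few by (simp add: card_DH power_mult)
  finally have few_P: "4 * (card ?E)\<^sup>2 * card ?P \<le> card K ^ card ?E" .
  have E: "finite ?E" "?E \<noteq> {}" "?E \<subseteq> carrier G"
    using D H \<open>D \<noteq> {}\<close> \<open>H \<noteq> {}\<close> set_mult_closed by (auto simp: finite_set_mult set_mult_def)
  have "K \<noteq> {}" "finite ?P"
    using y \<open>D \<noteq> {}\<close> finite_PiE[OF E(1), of "\<lambda>_. K"] K by auto
  then obtain x where x: "x \<in> carrier G \<rightarrow>\<^sub>E K"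
    and avoids: "\<And>\<gamma>. \<gamma> \<in> carrier G \<Longrightarrow> (\<lambda>e\<in>?E. x (e \<otimes> \<gamma>)) \<notin> ?P"
    using ex_colouring_avoiding_translates[OF E K _ _ few_P] by blast
  have "\<exists>h\<in>H. \<forall>d\<in>D. x (d \<otimes> h \<otimes> \<gamma>) = y d" if \<gamma>: "\<gamma> \<in> carrier G" for \<gamma>
  proof -
    have "(\<lambda>e\<in>?E. x (e \<otimes> \<gamma>)) \<in> ?E \<rightarrow>\<^sub>E K"
      using x \<gamma> E(3) by auto
    then obtain h where h: "h \<in> H"
      and match: "\<And>d. d \<in> D \<Longrightarrow> (\<lambda>e\<in>?E. x (e \<otimes> \<gamma>)) (d \<otimes> h) = y d"
      using avoids[OF \<gamma>] by auto
    have "d \<otimes> h \<in> ?E" if "d \<in> D" for d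
      using that h by (auto simp: set_mult_def)
    with h match show ?thesis
      by auto
  qed
  with x show ?thesis
    by blast
qed

end

lemma (in group_action) traps_translates_iff:
  assumes "F \<subseteq> carrier G" "V \<subseteq> E" "x \<in> E"
  shows "traps G \<phi> (translates \<phi> F V) x \<longleftrightarrow> (\<forall>\<gamma>\<in>carrier G. \<exists>\<sigma>\<in>F. \<phi> (inv \<sigma> \<otimes> \<gamma>) x \<in> V)"
proof -
  interpret group G
    by (rule group_hom.axioms(1)[OF group_hom])
  have "\<phi> \<gamma> x = \<phi> \<sigma> v \<longleftrightarrow> \<phi> (inv \<sigma> \<otimes> \<gamma>) x = v"
    if "\<gamma> \<in> carrier G" "\<sigma> \<in> F" "v \<in> V" for \<gamma> \<sigma> v
  proof -
    have "\<sigma> \<in> carrier G" "v \<in> E" "\<phi> \<gamma> x \<in> E"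
      using that assms element_image by auto
    then show ?thesis
      using that assms(3) orbit_sym_aux[of \<sigma> v "\<phi> \<gamma> x"] orbit_sym_aux[of "inv \<sigma>" "\<phi> \<gamma> x" v]
      by (auto simp: composition_rule)
  qed
  then show ?thesis
    by (fastforce simp: traps_def orbit_def translates_def)
qed

lemma (in group) ex_shift_cylinder_subset:
  assumes "openin (shift_space k G) V" "V \<noteq> {}"
  obtains y D where "y \<in> topspace (shift_space k G)" "finite D" "D \<noteq> {}" "D \<subseteq> carrier G"
    "cylinder (carrier G) (\<lambda>_. {..<k}) y D \<subseteq> V"
proof -
  obtain y where "y \<in> V"
    using assms(2) by blast
  then obtain D where "finite D" "D \<subseteq> carrier G" "cylinder (carrier G) (\<lambda>_. {..<k}) y D \<subseteq> V"
    using ex_cylinder_subset[OF assms(1)[unfolded shift_space_def]] by blast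
  moreover have "y \<in> topspace (shift_space k G)"
    using openin_subset[OF assms(1)] \<open>y \<in> V\<close> by blast
  ultimately show thesis
    by (intro that[of y "insert \<one> D"]) (auto simp: cylinder_def)
qed

lemma shift_act_mem_cylinder_iff:
  assumes "group G" "x \<in> topspace (shift_space k G)" "g \<in> carrier G" "D \<subseteq> carrier G"
  shows "shift_act k G g x \<in> cylinder (carrier G) (\<lambda>_. {..<k}) y D \<longleftrightarrow>
    (\<forall>d\<in>D. x (d \<otimes>\<^bsub>G\<^esub> g) = y d)"
proof -
  have "shift_act k G g x \<in> carrier G \<rightarrow>\<^sub>E {..<k}"
    using shift_act_closed[OF assms(1,3,2)] by (simp add: topspace_shift_space)
  moreover have "shift_act k G g x d = x (d \<otimes>\<^bsub>G\<^esub> g)" if "d \<in> D" for d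
    using that assms by (auto simp: shift_act_def)
  ultimately show ?thesis
    by (simp add: cylinder_def)
qed

lemma (in group) traps_translates_if_matching:
  assumes F: "F \<subseteq> carrier G" and D: "D \<subseteq> carrier G"
    and V: "V \<subseteq> topspace (shift_space k G)" "cylinder (carrier G) (\<lambda>_. {..<k}) y D \<subseteq> V"
    and x: "x \<in> topspace (shift_space k G)"
    and match: "\<And>\<gamma>. \<gamma> \<in> carrier G \<Longrightarrow> \<exists>\<sigma>\<in>F. \<forall>d\<in>D. x (d \<otimes> inv \<sigma> \<otimes> \<gamma>) = y d"
  shows "traps G (shift_act k G) (translates (shift_act k G) F V) x"
proof -
  interpret shift: group_action G "topspace (shift_space k G)" "shift_act k G"
    by (rule shift_act_group_action) (rule is_group)
  have "\<exists>\<sigma>\<in>F. shift_act k G (inv \<sigma> \<otimes> \<gamma>) x \<in> V" if \<gamma>: "\<gamma> \<in> carrier G" for \<gamma>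
  proof -
    obtain \<sigma> where "\<sigma> \<in> F" and eq: "\<And>d. d \<in> D \<Longrightarrow> x (d \<otimes> inv \<sigma> \<otimes> \<gamma>) = y d"
      using match[OF \<gamma>] by blast
    then have \<sigma>: "\<sigma> \<in> carrier G"
      using F by auto
    then have "x (d \<otimes> (inv \<sigma> \<otimes> \<gamma>)) = y d" if "d \<in> D" for d
      using eq[OF that] that D \<gamma> by (simp add: m_assoc subset_iff)
    then have "shift_act k G (inv \<sigma> \<otimes> \<gamma>) x \<in> cylinder (carrier G) (\<lambda>_. {..<k}) y D"
      using \<sigma> \<gamma> D x by (simp add: shift_act_mem_cylinder_iff is_group)
    with \<open>\<sigma> \<in> F\<close> V(2) show ?thesis
      by blast
  qed
  then show ?thesis
    using shift.traps_translates_iff[OF F V(1) x] by blast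
qed

lemma (in group) ex_trapped_point:
  assumes D: "finite D" "D \<noteq> {}" "D \<subseteq> carrier G" and F: "finite F" "F \<subseteq> carrier G"
    and y: "y \<in> topspace (shift_space k G)"
    and V: "V \<subseteq> topspace (shift_space k G)" "cylinder (carrier G) (\<lambda>_. {..<k}) y D \<subseteq> V"
    and "N > 0" and large: "N * (card D)\<^sup>2 \<le> card F"
    and few: "4 * (card D * N)\<^sup>2 * (k ^ card D - 1) ^ N \<le> (k ^ card D) ^ N"
  shows "\<exists>x \<in> topspace (shift_space k G).
    traps G (shift_act k G) (translates (shift_act k G) F V) x"
proof -
  have "card (m_inv G ` F) = card F"
    using inj_on_subset[OF inv_inj F(2)] by (rule card_image)
  then obtain H where H: "H \<subseteq> m_inv G ` F" "card H = N" "card (D <#> H) = card D * N"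
    using ex_subset_card_set_mult[OF D, of "m_inv G ` F" N] F large by auto
  have H_fin: "finite H" "H \<subseteq> carrier G" "H \<noteq> {}"
    using finite_subset[OF H(1)] H(1,2) F \<open>N > 0\<close> by auto
  have y_D: "y \<in> D \<rightarrow> {..<k}"
    using y D(3) by (auto simp: topspace_shift_space)
  have "\<exists>x \<in> carrier G \<rightarrow>\<^sub>E {..<k}. \<forall>\<gamma>\<in>carrier G. \<exists>h\<in>H. \<forall>d\<in>D. x (d \<otimes> h \<otimes> \<gamma>) = y d"
    using D H_fin y_D H(2,3) few by (intro ex_colouring_matching_translates) simp_all
  then obtain x where x: "x \<in> topspace (shift_space k G)"
    and match: "\<And>\<gamma>. \<gamma> \<in> carrier G \<Longrightarrow> \<exists>h\<in>H. \<forall>d\<in>D. x (d \<otimes> h \<otimes> \<gamma>) = y d"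
    unfolding topspace_shift_space by blast
  have "\<exists>\<sigma>\<in>F. \<forall>d\<in>D. x (d \<otimes> inv \<sigma> \<otimes> \<gamma>) = y d" if "\<gamma> \<in> carrier G" for \<gamma>
    using match[OF that] H(1) by blast
  then have "traps G (shift_act k G) (translates (shift_act k G) F V) x"
    by (rule traps_translates_if_matching[OF F(2) D(3) V x])
  with x show ?thesis
    by blast
qed

theorem theorem1p2:
  fixes G :: "('a, 'b) monoid_scheme" and k :: nat and V :: "('a \<Rightarrow> nat) set"
  assumes "group G" and "infinite (carrier G)"
    and "k \<ge> 1"
    and "openin (shift_space k G) V" and "V \<noteq> {}"
  shows "\<exists>n::nat. \<forall>F. F \<subseteq> carrier G \<and> finite F \<and> card F \<ge> n \<longrightarrow>
           (\<exists>x \<in> topspace (shift_space k G).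
              traps G (shift_act k G) (translates (shift_act k G) F V) x)"
proof -
  interpret group G by fact
  obtain y D where y: "y \<in> topspace (shift_space k G)"
    and D: "finite D" "D \<noteq> {}" "D \<subseteq> carrier G" "cylinder (carrier G) (\<lambda>_. {..<k}) y D \<subseteq> V"
    using assms(4,5) by (rule ex_shift_cylinder_subset)
  have "k ^ card D - 1 < k ^ card D"
    using assms(3) by simp
  then obtain N where N: "N > 0" "4 * (card D * N)\<^sup>2 * (k ^ card D - 1) ^ N \<le> (k ^ card D) ^ N"
    by (rule ex_square_times_power_le)
  show ?thesis
  proof (intro exI allI impI, elim conjE)
    fix F assume "F \<subseteq> carrier G" "finite F" "card F \<ge> N * (card D)\<^sup>2"
    then show "\<exists>x \<in> topspace (shift_space k G).
        traps G (shift_act k G) (translates (shift_act k G) F V) x"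
      using D y N openin_subset[OF assms(4)] by (intro ex_trapped_point[of D F y k V N])
  qed
qed

end
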